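(* The least order of a noncommutative even square ring of even order is eight, and such a ring is a nil ring of characteristic four. That is: (i) there exists a noncommutative even square ring of order $8$; (ii) there is no noncommutative even square ring whose order is finite, even and less than $8$; (iii) every noncommutative even square ring of order $8$ is a nil ring and has characteristic $4$.
   Context: Rings are associative and are not assumed to have a multiplicative identity. A ring $R$ is called an even square ring if $a^2 \in 2R$ for all $a \in R$, where $2R = \{2r : r \in R\}$ and $2r = r + r$. The order of a finite ring is its number of elements. The characteristic of a ring $R$ is the least positive integer $n$ such that $nr = 0$ for all $r \in R$ (and $0$ if no such $n$ exists). A ring is nil if each of its elements is nilpotent. *)

theory Defs
  imports "HOL-Algebra.Ring" "HOL-Algebra.Coset"
begin

text \<open>
  The library locale \<open>ring\<close> requires a multiplicative identity. We reuse its record type and its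
  additive part \<open>abelian_group\<close>, but put no condition on the field \<open>one\<close>: nothing below
  refers to \<open>\<one>\<close>. In particular the library power \<open>x [^] n\<close> is not used for
  multiplication, since it is computed starting from \<open>\<one>\<close>.
\<close>

locale nonunital_ring = abelian_group R for R (structure) +
  assumes m_closed [intro, simp]:
      "\<lbrakk>x \<in> carrier R; y \<in> carrier R\<rbrakk> \<Longrightarrow> x \<otimes> y \<in> carrier R"
    and m_assoc:
      "\<lbrakk>x \<in> carrier R; y \<in> carrier R; z \<in> carrier R\<rbrakk> \<Longrightarrow> (x \<otimes> y) \<otimes> z = x \<otimes> (y \<otimes> z)"
    and l_distr:
      "\<lbrakk>x \<in> carrier R; y \<in> carrier R; z \<in> carrier R\<rbrakk> \<Longrightarrow> (x \<oplus> y) \<otimes> z = x \<otimes> z \<oplus> y \<otimes> z"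
    and r_distr:
      "\<lbrakk>x \<in> carrier R; y \<in> carrier R; z \<in> carrier R\<rbrakk> \<Longrightarrow> z \<otimes> (x \<oplus> y) = z \<otimes> x \<oplus> z \<otimes> y"

definition noncommutative :: "('a, 'm) ring_scheme \<Rightarrow> bool" where
  "noncommutative R \<longleftrightarrow>
     (\<exists>x\<in>carrier R. \<exists>y\<in>carrier R. x \<otimes>\<^bsub>R\<^esub> y \<noteq> y \<otimes>\<^bsub>R\<^esub> x)"

definition doubles :: "('a, 'm) ring_scheme \<Rightarrow> 'a set" where
  "doubles R = {r \<oplus>\<^bsub>R\<^esub> r | r. r \<in> carrier R}"

definition even_square_ring :: "('a, 'm) ring_scheme \<Rightarrow> bool" where
  "even_square_ring R \<longleftrightarrow>
     nonunital_ring R \<and> (\<forall>a\<in>carrier R. a \<otimes>\<^bsub>R\<^esub> a \<in> doubles R)"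

text \<open>\<open>power_Suc R a n\<close> is the power of \<open>a\<close> with exponent \<open>Suc n\<close>.\<close>

primrec power_Suc :: "('a, 'm) ring_scheme \<Rightarrow> 'a \<Rightarrow> nat \<Rightarrow> 'a" where
  "power_Suc R a 0 = a"
| "power_Suc R a (Suc n) = power_Suc R a n \<otimes>\<^bsub>R\<^esub> a"

definition nilpotent :: "('a, 'm) ring_scheme \<Rightarrow> 'a \<Rightarrow> bool" where
  "nilpotent R a \<longleftrightarrow> (\<exists>n. power_Suc R a n = \<zero>\<^bsub>R\<^esub>)"

definition nil_ring :: "('a, 'm) ring_scheme \<Rightarrow> bool" where
  "nil_ring R \<longleftrightarrow> nonunital_ring R \<and> (\<forall>a\<in>carrier R. nilpotent R a)"

definition annihilates :: "('a, 'm) ring_scheme \<Rightarrow> nat \<Rightarrow> bool" where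
  "annihilates R n \<longleftrightarrow> (\<forall>r\<in>carrier R. [n] \<cdot>\<^bsub>R\<^esub> r = \<zero>\<^bsub>R\<^esub>)"

definition characteristic :: "('a, 'm) ring_scheme \<Rightarrow> nat" where
  "characteristic R =
     (if \<exists>n>0. annihilates R n then LEAST n. n > 0 \<and> annihilates R n else 0)"

lemma (in ring) nonunital_ring: "nonunital_ring R"
  by unfold_locales (auto simp: m_assoc l_distr r_distr)

lemma (in ring) power_Suc_eq_nat_pow:
  "a \<in> carrier R \<Longrightarrow> power_Suc R a n = a [^] Suc n"
  by (induction n) auto

end

theory Submission
  imports Defs "HOL-Algebra.Multiplicative_Group"
begin

text \<open>
  The driving observation is additive: a noncommuting pair \<open>x\<close>, \<open>y\<close> in a finite ring of order \<open>n\<close>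
  forces the additive order \<open>k\<close> of \<open>x\<close> to have a common factor with \<open>n / k\<close>. The centralizer of \<open>x\<close>
  is an additive subgroup; it contains \<open>k y\<close>, because \<open>x (k y) = (k x) y = 0\<close> and likewise on the
  other side, and it contains \<open>(n / k) y\<close>, because \<open>n / k\<close> is the index of the additive
  subgroup generated by \<open>x\<close>, which therefore contains this multiple. If \<open>k\<close> and \<open>n / k\<close>
  were coprime, then \<open>y\<close> itself would commute with \<open>x\<close> (lemma \<open>noncommuting_not_coprime\<close>).

  For \<open>n \<le> 8\<close> this leaves \<open>n = 4\<close> with \<open>k = 2\<close>, and \<open>n = 8\<close> with \<open>k \<in> {2, 4}\<close>, so that
  every noncentral element is killed by \<open>n / 2\<close>. A central element is the difference of two noncentral
  ones, so \<open>n / 2\<close> kills the whole ring (lemma \<open>small_noncommutative\<close>).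

  The even square condition enters in two ways. If \<open>2 R = 0\<close>, all squares vanish, hence
  \<open>x y = - y x = y x\<close>; this rules out \<open>n = 4\<close>, and shows that the characteristic cannot divide \<open>2\<close>
  for \<open>n = 8\<close>. If \<open>4 R = 0\<close>, then \<open>a\<^sup>4 = (2 r) (2 r) = 4 r\<^sup>2 = 0\<close>, where \<open>a\<^sup>2 = 2 r\<close>.

  A ring of order \<open>8\<close> is obtained on \<open>\<int>/4 \<times> \<int>/2\<close> from a nonsymmetric bilinear form with values in
  \<open>{0, 2} \<times> {0}\<close>, a set that the form annihilates, so that associativity is trivial.
\<close>

section \<open>Multiples of an element lying in a subgroup\<close>

text \<open>
  The index of \<open>H\<close> is the order of the quotient by \<open>H\<close>, in which the coset of \<open>x\<close> raised to
  this power is trivial.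
\<close>

lemma (in comm_group) pow_index_mem_subgroup:
  assumes "finite (carrier G)" "subgroup H G" "x \<in> carrier G"
  shows "x [^] (order G div card H) \<in> H"
proof -
  interpret H: normal H G
    by (rule subgroup_imp_normal[OF assms(2)])
  interpret Q: group "G Mod H"
    by (rule H.factorgroup_is_group)
  interpret proj: group_hom G "G Mod H" "\<lambda>a. H #> a"
    by unfold_locales (rule H.r_coset_hom_Mod)
  have "card H > 0"
    using assms(1) H.subset H.one_closed by (metis card_gt_0_iff empty_iff finite_subset)
  then have index: "order (G Mod H) = order G div card H"
    using lagrange[OF assms(2)]
    by (metis FactGroup_def nonzero_mult_div_cancel_right less_numeral_extra(3) order_def
        partial_object.select_convs(1))
  have "H #> (x [^] (order G div card H)) = (H #> x) [^]\<^bsub>G Mod H\<^esub> order (G Mod H)"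
    using assms(3) by (simp add: proj.hom_nat_pow index)
  also have "\<dots> = H"
    using Q.pow_order_eq_1[OF proj.hom_closed[OF assms(3)]] by simp
  finally show ?thesis
    using coset_join1 assms(2,3) by blast
qed

lemma (in group) mem_subgroup_if_coprime_powers:
  fixes k m :: nat
  assumes H: "subgroup H G" and x: "x \<in> carrier G"
    and powers: "x [^] k \<in> H" "x [^] m \<in> H" and "coprime k m"
  shows "x \<in> H"
proof -
  obtain u v :: int where uv: "u * int k + v * int m = 1"
    using \<open>coprime k m\<close> bezout_int[of "int k" "int m"] by (auto simp: coprime_iff_gcd_eq_1)
  have "x = x [^] (int k * u + int m * v)"
    using uv x by (simp add: mult.commute)
  also have "\<dots> = (x [^] k) [^] u \<otimes> (x [^] m) [^] v"
    using x by (simp add: int_pow_mult flip: int_pow_pow int_pow_int)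
  also have "\<dots> \<in> H"
    using H powers by (intro subgroup.m_closed subgroup_int_pow_closed)
  finally show ?thesis .
qed

section \<open>The additive group of a noncommutative ring\<close>

context nonunital_ring
begin

lemma l_null [simp]: "x \<in> carrier R \<Longrightarrow> \<zero> \<otimes> x = \<zero>"
  by (metis l_distr l_zero m_closed add.r_cancel_one zero_closed)

lemma r_null [simp]: "x \<in> carrier R \<Longrightarrow> x \<otimes> \<zero> = \<zero>"
  by (metis r_distr l_zero m_closed add.r_cancel_one zero_closed)

lemma l_minus:
  assumes "x \<in> carrier R" "y \<in> carrier R"
  shows "(\<ominus> x) \<otimes> y = \<ominus> (x \<otimes> y)"
proof -
  have "(\<ominus> x) \<otimes> y \<oplus> x \<otimes> y = \<zero>"
    using assms by (simp add: l_neg flip: l_distr)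
  then show ?thesis
    using assms by (metis a_inv_closed m_closed minus_equality)
qed

lemma r_minus:
  assumes "x \<in> carrier R" "y \<in> carrier R"
  shows "x \<otimes> (\<ominus> y) = \<ominus> (x \<otimes> y)"
proof -
  have "x \<otimes> (\<ominus> y) \<oplus> x \<otimes> y = \<zero>"
    using assms by (simp add: l_neg flip: r_distr)
  then show ?thesis
    using assms by (metis a_inv_closed m_closed minus_equality)
qed

lemma multiple_mult_left:
  assumes "x \<in> carrier R" "y \<in> carrier R"
  shows "([n] \<cdot> x) \<otimes> y = [(n::nat)] \<cdot> (x \<otimes> y)"
  using assms by (induction n) (auto simp: l_distr)

lemma multiple_mult_right:
  assumes "x \<in> carrier R" "y \<in> carrier R"
  shows "x \<otimes> ([n] \<cdot> y) = [(n::nat)] \<cdot> (x \<otimes> y)"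
  using assms by (induction n) (auto simp: r_distr)

lemma subgroup_centralizer:
  assumes "x \<in> carrier R"
  shows "subgroup {y \<in> carrier R. x \<otimes> y = y \<otimes> x} (add_monoid R)"
  using assms
  by (intro add.subgroupI) (auto simp: l_distr r_distr l_minus r_minus simp flip: a_inv_def)

text \<open>
  The additive order of \<open>x\<close> and the index of the additive subgroup that \<open>x\<close> generates are two
  multipliers that move \<open>y\<close> into the centralizer of \<open>x\<close>; if they were coprime, an integer
  combination of the two multiples would be \<open>y\<close> itself. In particular a finite ring of squarefree
  order is commutative.
\<close>

lemma noncommuting_not_coprime:
  assumes fin: "finite (carrier R)" and x: "x \<in> carrier R" and y: "y \<in> carrier R"
    and nc: "x \<otimes> y \<noteq> y \<otimes> x"
  shows "\<not> coprime (group.ord (add_monoid R) x) (order R div group.ord (add_monoid R) x)"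
proof
  let ?k = "group.ord (add_monoid R) x"
  let ?X = "generate (add_monoid R) {x}"
  let ?C = "{y \<in> carrier R. x \<otimes> y = y \<otimes> x}"
  assume "coprime ?k (order R div ?k)"
  have X: "subgroup ?X (add_monoid R)"
    using x by (intro add.generate_is_subgroup) auto
  have kx: "[?k] \<cdot> x = \<zero>"
    using add.pow_ord_eq_1[of x] x by simp
  have "x \<otimes> ([?k] \<cdot> y) = \<zero>"
    using x y kx multiple_mult_left[of x y ?k] by (simp add: multiple_mult_right)
  moreover have "([?k] \<cdot> y) \<otimes> x = \<zero>"
    using x y kx multiple_mult_right[of y x ?k] by (simp add: multiple_mult_left)
  ultimately have "[?k] \<cdot> y \<in> ?C"
    using y by simp
  moreover have "[(order R div ?k)] \<cdot> y \<in> ?C"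
  proof -
    have "?X \<subseteq> ?C"
      using x by (intro add.generate_subgroup_incl subgroup_centralizer) auto
    moreover have "[(order R div ?k)] \<cdot> y \<in> ?X"
      using add.pow_index_mem_subgroup[OF _ X, of y] add.generate_pow_card[of x] fin x y
      by (simp add: order_def)
    ultimately show ?thesis
      by blast
  qed
  ultimately have "y \<in> ?C"
    using add.mem_subgroup_if_coprime_powers[OF subgroup_centralizer[OF x], of y]
      \<open>coprime ?k (order R div ?k)\<close> y
    by simp
  with nc show False
    by simp
qed

text \<open>
  A central \<open>z\<close> is the difference of \<open>x + z\<close> and \<open>x\<close>, and \<open>x + z\<close> fails to commute
  with the same elements as \<open>x\<close>.
\<close>

lemma annihilates_if_kills_noncentral:
  assumes "noncommutative R"
    and kill: "\<And>x y. x \<in> carrier R \<Longrightarrow> y \<in> carrier R \<Longrightarrow> x \<otimes> y \<noteq> y \<otimes> x \<Longrightarrow> [(m::nat)] \<cdot> x = \<zero>"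
  shows "annihilates R m"
  unfolding annihilates_def
proof
  fix z assume z: "z \<in> carrier R"
  obtain x y where xy: "x \<in> carrier R" "y \<in> carrier R" "x \<otimes> y \<noteq> y \<otimes> x"
    using assms(1) unfolding noncommutative_def by blast
  show "[m] \<cdot> z = \<zero>"
  proof (cases "z \<otimes> y = y \<otimes> z")
    case False
    with kill z xy show ?thesis by blast
  next
    case True
    then have "(x \<oplus> z) \<otimes> y \<noteq> y \<otimes> (x \<oplus> z)"
      using z xy by (simp add: l_distr r_distr)
    then have "[m] \<cdot> (x \<oplus> z) = \<zero>"
      using kill z xy by blast
    moreover have "[m] \<cdot> x = \<zero>"
      using kill xy by blast
    ultimately show ?thesis
      using z xy by (simp add: add.nat_pow_distrib)
  qed
qed

text \<open>
  The product of two noncoprime factors that is at most \<open>8\<close> is \<open>2 \<cdot> 2\<close> or \<open>2 \<cdot> 4\<close>; in both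
  cases each factor divides half of the product.
\<close>

lemma small_noncommutative:
  assumes nc: "noncommutative R" and fin: "finite (carrier R)" and "order R \<le> 8"
  shows "order R \<in> {4, 8} \<and> annihilates R (order R div 2)"
proof -
  have noncentral: "order R \<in> {4, 8} \<and> [(order R div 2)] \<cdot> x = \<zero>"
    if x: "x \<in> carrier R" and y: "y \<in> carrier R" "x \<otimes> y \<noteq> y \<otimes> x" for x y
  proof -
    define k where "k = group.ord (add_monoid R) x"
    define m where "m = order R div k"
    have "k dvd order R"
      using add.ord_dvd_group_order[of x] x by (simp add: k_def order_def)
    then have km: "order R = k * m"
      by (simp add: m_def)
    have ncop: "\<not> coprime k m"
      using noncommuting_not_coprime[OF fin x y] by (simp add: k_def m_def)
    have "order R > 0"
      using fin x by (auto simp: order_def card_gt_0_iff)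
    \<comment> \<open>A factor \<open>1\<close> is coprime to everything, and a factor \<open>0\<close> would make the order vanish.\<close>
    with km ncop have "k \<ge> 2" "m \<ge> 2"
      by (cases k; cases "k - 1"; cases m; cases "m - 1"; simp)+
    moreover from this have "k * 2 \<le> k * m" "2 * m \<le> k * m"
      by simp_all
    with km \<open>order R \<le> 8\<close> have "k \<le> 4" "m \<le> 4" "k * m \<le> 8"
      by linarith+
    ultimately have "k \<in> {2, 3, 4}" "m \<in> {2, 3, 4}"
      by auto
    with ncop \<open>k * m \<le> 8\<close> have cases: "(k, m) \<in> {(2, 2), (2, 4), (4, 2)}"
      by auto
    have "[k] \<cdot> x = \<zero>"
      using add.pow_ord_eq_1[of x] x by (simp add: k_def)
    moreover have "k dvd order R div 2"
      using cases km by auto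
    ultimately have "[(order R div 2)] \<cdot> x = \<zero>"
      using x by (metis dvdE add.nat_pow_pow add.nat_pow_one)
    with cases km show ?thesis
      by auto
  qed
  with nc have "order R \<in> {4, 8}"
    unfolding noncommutative_def by blast
  then show ?thesis
    using annihilates_if_kills_noncentral[OF nc] noncentral by blast
qed

end

section \<open>Even square rings\<close>

lemma multiple_two:
  assumes "abelian_group R" "x \<in> carrier R"
  shows "[(2::nat)] \<cdot>\<^bsub>R\<^esub> x = x \<oplus>\<^bsub>R\<^esub> x"
proof -
  interpret abelian_group R by fact
  show ?thesis
    using assms(2) by (simp add: numeral_2_eq_2)
qed

text \<open>
  Here all squares vanish, so expanding \<open>(x + y)\<^sup>2\<close> shows that \<open>x y\<close> is the negative of \<open>y x\<close>,
  and every element is its own negative.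
\<close>

lemma commutative_if_annihilates_two:
  assumes R: "even_square_ring R" and two: "annihilates R 2"
  shows "\<not> noncommutative R"
proof -
  interpret nonunital_ring R
    using R by (simp add: even_square_ring_def)
  have double: "z \<oplus>\<^bsub>R\<^esub> z = \<zero>\<^bsub>R\<^esub>" if "z \<in> carrier R" for z
    using two that multiple_two[OF abelian_group_axioms] by (auto simp: annihilates_def)
  have square: "z \<otimes>\<^bsub>R\<^esub> z = \<zero>\<^bsub>R\<^esub>" if "z \<in> carrier R" for z
    using R that double unfolding even_square_ring_def doubles_def by fastforce
  have "x \<otimes>\<^bsub>R\<^esub> y = y \<otimes>\<^bsub>R\<^esub> x" if "x \<in> carrier R" "y \<in> carrier R" for x y
  proof -
    have "x \<otimes>\<^bsub>R\<^esub> y \<oplus>\<^bsub>R\<^esub> y \<otimes>\<^bsub>R\<^esub> x = (x \<oplus>\<^bsub>R\<^esub> y) \<otimes>\<^bsub>R\<^esub> (x \<oplus>\<^bsub>R\<^esub> y)"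
      using that square[of x] square[of y] by (simp add: l_distr r_distr a_comm)
    also have "\<dots> = y \<otimes>\<^bsub>R\<^esub> x \<oplus>\<^bsub>R\<^esub> y \<otimes>\<^bsub>R\<^esub> x"
      using that square[of "x \<oplus>\<^bsub>R\<^esub> y"] double[of "y \<otimes>\<^bsub>R\<^esub> x"] by simp
    finally show ?thesis
      using that by simp
  qed
  then show ?thesis
    by (auto simp: noncommutative_def)
qed

text \<open>
  The square of a double is four times a square, so all fourth powers vanish.
\<close>

lemma nil_ring_if_annihilates_four:
  assumes R: "even_square_ring R" and four: "annihilates R 4"
  shows "nil_ring R"
  unfolding nil_ring_def nilpotent_def
proof (intro conjI ballI)
  show "nonunital_ring R"
    using R by (simp add: even_square_ring_def)
  then interpret nonunital_ring R .
  fix a assume a: "a \<in> carrier R"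
  then obtain r where r: "r \<in> carrier R" "a \<otimes>\<^bsub>R\<^esub> a = r \<oplus>\<^bsub>R\<^esub> r"
    using R unfolding even_square_ring_def doubles_def by blast
  have "power_Suc R a 3 = (a \<otimes>\<^bsub>R\<^esub> a) \<otimes>\<^bsub>R\<^esub> (a \<otimes>\<^bsub>R\<^esub> a)"
    using a by (simp add: numeral_3_eq_3 m_assoc)
  also have "\<dots> = [(2::nat)] \<cdot>\<^bsub>R\<^esub> ([(2::nat)] \<cdot>\<^bsub>R\<^esub> (r \<otimes>\<^bsub>R\<^esub> r))"
    using r multiple_two[OF abelian_group_axioms r(1)]
    by (metis add.nat_pow_closed multiple_mult_left multiple_mult_right)
  also have "\<dots> = [(4::nat)] \<cdot>\<^bsub>R\<^esub> (r \<otimes>\<^bsub>R\<^esub> r)"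
    using r by (simp add: add.nat_pow_pow)
  also have "\<dots> = \<zero>\<^bsub>R\<^esub>"
    using four r by (simp add: annihilates_def)
  finally show "\<exists>n. power_Suc R a n = \<zero>\<^bsub>R\<^esub>" ..
qed

lemma characteristic_four:
  assumes R: "even_square_ring R" and nc: "noncommutative R" and four: "annihilates R 4"
  shows "characteristic R = 4"
proof -
  interpret nonunital_ring R
    using R by (simp add: even_square_ring_def)
  have not_two: "\<not> annihilates R 2"
    using commutative_if_annihilates_two R nc by blast
  have "n \<ge> 4" if "n > 0" "annihilates R n" for n
  proof (rule ccontr)
    assume "\<not> n \<ge> 4"
    with that not_two consider "n = 1" | "n = 3"
      by (cases "n = 2") (auto, linarith)
    \<comment> \<open>As \<open>n\<close> and \<open>4\<close> are coprime and both annihilate, the ring is zero.\<close>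
    then have "r = \<zero>\<^bsub>R\<^esub>" if r: "r \<in> carrier R" for r
    proof cases
      case 1
      then show ?thesis
        using \<open>annihilates R n\<close> r by (auto simp: annihilates_def)
    next
      case 2
      then have "[(3::nat)] \<cdot>\<^bsub>R\<^esub> r = \<zero>\<^bsub>R\<^esub>" "[Suc 3] \<cdot>\<^bsub>R\<^esub> r = \<zero>\<^bsub>R\<^esub>"
        using \<open>annihilates R n\<close> four r by (auto simp: annihilates_def)
      then show ?thesis
        using r by (simp only: add.nat_pow_Suc l_zero)
    qed
    then have "annihilates R 2"
      by (metis annihilates_def add.nat_pow_closed)
    with not_two show False ..
  qed
  then have "(LEAST n. n > 0 \<and> annihilates R n) = 4"
    using four by (intro Least_equality) auto
  then show ?thesis
    using four unfolding characteristic_def by (metis zero_less_numeral)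
qed

section \<open>An example of order eight\<close>

text \<open>
  The number \<open>a + 4 b\<close> with \<open>a < 4\<close>, \<open>b < 2\<close> encodes the pair \<open>(a, b)\<close> of \<open>\<int>/4 \<times> \<int>/2\<close>, and the
  product of \<open>(a, b)\<close> and \<open>(c, d)\<close> is \<open>(2 a d, 0)\<close>.
\<close>

definition example_ring :: "nat ring" where
  "example_ring =
     \<lparr> carrier = {..<8},
       mult = (\<lambda>m n. if odd m \<and> odd (n div 4) then 2 else 0),
       one = 0,
       zero = 0,
       add = (\<lambda>m n. (m + n) mod 4 + 4 * ((m div 4 + n div 4) mod 2)) \<rparr>"

lemma nonunital_ring_example: "nonunital_ring example_ring"
proof (rule nonunital_ring.intro)
  have less_8: "a mod 4 + 4 * (b mod 2) < (8::nat)" for a b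
    using mod_less_divisor[of 4 a] mod_less_divisor[of 2 b] by linarith
  have decode: "x mod 4 + 4 * (x div 4 mod 2) = x" if "x < 8" for x :: nat
    using that by (simp add: less_mult_imp_div_less)
  have add_mod: "(a mod 4 + 4 * b + c) mod 4 = (a + c) mod (4::nat)"
    "(c + (a mod 4 + 4 * b)) mod 4 = (c + a) mod (4::nat)" for a b c
    by (metis mod_add_left_eq mod_mod_trivial mod_mult_self2)
      (metis mod_add_right_eq mod_mod_trivial mod_mult_self2)
  show "abelian_group example_ring"
  proof (rule abelian_groupI)
    fix x assume x: "x \<in> carrier example_ring"
    \<comment> \<open>The negative of \<open>(a, b)\<close> is \<open>(3 a, b)\<close>.\<close>
    let ?y = "3 * x mod 4 + 4 * (x div 4 mod 2)"
    have "?y \<oplus>\<^bsub>example_ring\<^esub> x = \<zero>\<^bsub>example_ring\<^esub>"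
      by (simp add: example_ring_def add_mod mod_simps flip: mult_2)
    moreover have "?y \<in> carrier example_ring"
      using less_8 by (simp add: example_ring_def)
    ultimately show "\<exists>y\<in>carrier example_ring. y \<oplus>\<^bsub>example_ring\<^esub> x = \<zero>\<^bsub>example_ring\<^esub>"
      by blast
  qed (simp_all add: example_ring_def less_8 decode add_mod mod_simps
      add.assoc add.commute add.left_commute)
  show "nonunital_ring_axioms example_ring"
    by unfold_locales (simp_all add: example_ring_def dvd_mod_iff)
qed

lemma even_square_ring_example: "even_square_ring example_ring"
proof -
  have "{0, 1} \<subseteq> carrier example_ring"
    by (auto simp: example_ring_def)
  then have "0 \<oplus>\<^bsub>example_ring\<^esub> 0 \<in> doubles example_ring"
    "1 \<oplus>\<^bsub>example_ring\<^esub> 1 \<in> doubles example_ring"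
    unfolding doubles_def by blast+
  then have "a \<otimes>\<^bsub>example_ring\<^esub> a \<in> doubles example_ring" for a
    by (simp add: example_ring_def flip: numeral_2_eq_2)
  with nonunital_ring_example show ?thesis
    by (simp add: even_square_ring_def)
qed

lemma noncommutative_example: "noncommutative example_ring"
proof -
  have "1 \<otimes>\<^bsub>example_ring\<^esub> 4 \<noteq> 4 \<otimes>\<^bsub>example_ring\<^esub> 1" "{1, 4} \<subseteq> carrier example_ring"
    by (auto simp: example_ring_def)
  then show ?thesis
    unfolding noncommutative_def by blast
qed

section \<open>The least order\<close>

theorem proposition3:
  shows "(\<exists>R :: nat ring. even_square_ring R \<and> noncommutative R \<and> order R = 8)
    \<and> \<not> (\<exists>R :: 'a ring. even_square_ring R \<and> noncommutative R
            \<and> finite (carrier R) \<and> even (order R) \<and> order R < 8)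
    \<and> (\<forall>R :: 'a ring. even_square_ring R \<and> noncommutative R \<and> order R = 8
            \<longrightarrow> nil_ring R \<and> characteristic R = 4)"
proof (intro conjI allI impI)
  have "order example_ring = 8"
    by (simp add: example_ring_def order_def)
  then show "\<exists>R :: nat ring. even_square_ring R \<and> noncommutative R \<and> order R = 8"
    using even_square_ring_example noncommutative_example by blast
next
  show "\<not> (\<exists>R :: 'a ring. even_square_ring R \<and> noncommutative R
            \<and> finite (carrier R) \<and> even (order R) \<and> order R < 8)"
  proof
    assume "\<exists>R :: 'a ring. even_square_ring R \<and> noncommutative R
            \<and> finite (carrier R) \<and> even (order R) \<and> order R < 8"
    then obtain R :: "'a ring" where R: "even_square_ring R" "noncommutative R"
      "finite (carrier R)" "order R < 8"
      by blast
    then have "order R \<in> {4, 8} \<and> annihilates R (order R div 2)"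
      by (intro nonunital_ring.small_noncommutative) (auto simp: even_square_ring_def)
    with R(4) have "annihilates R 2"
      by auto
    with R commutative_if_annihilates_two show False
      by blast
  qed
next
  fix R :: "'a ring"
  assume R: "even_square_ring R \<and> noncommutative R \<and> order R = 8"
  then have "finite (carrier R)"
    by (metis card.infinite order_def zero_neq_numeral)
  with R have "annihilates R (order R div 2)"
    using nonunital_ring.small_noncommutative[of R] by (simp add: even_square_ring_def)
  with R have "annihilates R 4"
    by simp
  with R show "nil_ring R" "characteristic R = 4"
    using nil_ring_if_annihilates_four characteristic_four by blast+
qed

end
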